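(* Let $p\in(0,1)$, $\alpha\in(0,1)$, let $k$ be an integer, and let $Z_1,\dots,Z_n$ be independent identically distributed real random variables with the law of an arbitrary real random variable $Z$, where $$n\geq \frac{\ln(\alpha)}{\ln(p)} .$$ If one observes that $\lfloor 2^{k}|Z_i|\rfloor$ is even for all $i\in\{1,2,\dots,n\}$, then the $k$-th bit of $Z$ is contributing with probability $p$ at confidence level $1-\alpha$; that is, if the $k$-th bit of $Z$ is not contributing with probability $p$, then $$\mathbb{P}\left(\forall i\in\{1,\dots,n\},\ \lfloor 2^{k}|Z_i|\rfloor \text{ is even}\right)\leq\alpha .$$
   Context: The $k$-th bit of $Z$ is said to be contributing with probability $p$ if and only if $\mathbb{P}\left(\lfloor 2^{k}|Z|\rfloor \text{ is even}\right)\geq p$. No assumption is made on the distribution of $Z$. The confidence level has the following meaning: a model (a value of the unknown success probability) is rejected at confidence level $1-\alpha$ when the probability of the observed outcome under it is at most $\alpha$. *)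

theory Defs
  imports "HOL-Probability.Probability"
begin

definition contributing_bit :: "'a measure \<Rightarrow> ('a \<Rightarrow> real) \<Rightarrow> int \<Rightarrow> real \<Rightarrow> bool" where
  "contributing_bit M Z k p \<longleftrightarrow>
     measure M {\<omega> \<in> space M. even \<lfloor>2 powi k * \<bar>Z \<omega>\<bar>\<rfloor>} \<ge> p"

end

theory Submission
  imports Defs
begin

text \<open>
  The theorem is the calibration of an \<open>n\<close>-fold repeated test.  Parity of the \<open>k\<close>-th bit is a
  Borel event \<open>E\<close> of the real line, so all sample points have an even bit exactly when every
  \<open>X i\<close> hits \<open>E\<close>.  By independence and identity in law this has probability \<open>q ^ n\<close>, where
  \<open>q\<close> is the probability that \<open>Z\<close> hits \<open>E\<close>; a bit that is not contributing has \<open>q < p\<close>, so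
  \<open>q ^ n \<le> p ^ n\<close>.  Since \<open>ln p\<close> is negative, the bound on the sample size says exactly that
  \<open>p ^ n \<le> \<alpha>\<close>.
\<close>

lemma power_le_of_ln_ratio_le:
  fixes p \<alpha> :: real
  assumes "0 < p" "p < 1" "0 < \<alpha>" "real n \<ge> ln \<alpha> / ln p"
  shows "p ^ n \<le> \<alpha>"
proof -
  have "ln p < 0" using assms by simp
  with assms(4) have "real n * ln p \<le> ln \<alpha>"
    by (simp add: divide_le_eq)
  then have "ln (p ^ n) \<le> ln \<alpha>"
    using assms(1) by (simp add: ln_realpow)
  then show ?thesis
    using assms(1,3) by simp
qed

lemma even_bit_borel: "{x :: real. even \<lfloor>2 powi k * \<bar>x\<bar>\<rfloor>} \<in> sets borel"
  by measurable

lemma (in prob_space) prob_all_iid_in: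
  assumes "finite I" "I \<noteq> {}" and indep: "indep_vars (\<lambda>_. S) X I" and "E \<in> sets S"
    and law: "\<And>i. i \<in> I \<Longrightarrow> distr M S (X i) = D"
  shows "prob {\<omega> \<in> space M. \<forall>i\<in>I. X i \<omega> \<in> E} = measure D E ^ card I"
proof -
  have "{\<omega> \<in> space M. \<forall>i\<in>I. X i \<omega> \<in> E} = (\<Inter>i\<in>I. X i -` E \<inter> space M)"
    using \<open>I \<noteq> {}\<close> by auto
  then have "prob {\<omega> \<in> space M. \<forall>i\<in>I. X i \<omega> \<in> E} = (\<Prod>i\<in>I. prob (X i -` E \<inter> space M))"
    using indep_varsD[OF indep \<open>I \<noteq> {}\<close> \<open>finite I\<close> order_refl] \<open>E \<in> sets S\<close> by simp
  also have "\<dots> = (\<Prod>i\<in>I. measure D E)"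
  proof (rule prod.cong)
    fix i assume "i \<in> I"
    have "random_variable S (X i)"
      using indep \<open>i \<in> I\<close> by (simp add: indep_vars_def)
    then show "prob (X i -` E \<inter> space M) = measure D E"
      using law[OF \<open>i \<in> I\<close>] \<open>E \<in> sets S\<close> by (metis measure_distr)
  qed simp
  finally show ?thesis by simp
qed

theorem mainTheorem5:
  fixes M :: "'a measure" and N :: "'b measure"
    and X :: "nat \<Rightarrow> 'a \<Rightarrow> real" and Z :: "'b \<Rightarrow> real"
    and p \<alpha> :: real and k :: int and n :: nat
  assumes "prob_space M" and "prob_space N"
    and "0 < p" and "p < 1" and "0 < \<alpha>" and "\<alpha> < 1"
    and "Z \<in> borel_measurable N"
    and "prob_space.indep_vars M (\<lambda>_. borel) X {1..n}"
    and "\<And>i. i \<in> {1..n} \<Longrightarrow> distr M borel (X i) = distr N borel Z"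
    and "real n \<ge> ln \<alpha> / ln p"
    and "\<not> contributing_bit N Z k p"
  shows "measure M {\<omega> \<in> space M. \<forall>i\<in>{1..n}. even \<lfloor>2 powi k * \<bar>X i \<omega>\<bar>\<rfloor>} \<le> \<alpha>"
proof -
  interpret M: prob_space M by fact
  define E where "E = {x :: real. even \<lfloor>2 powi k * \<bar>x\<bar>\<rfloor>}"
  have E: "E \<in> sets borel"
    unfolding E_def by (rule even_bit_borel)
  \<comment> \<open>The empty sample would leave nothing to intersect; it is excluded because \<open>\<alpha> < 1\<close>
    makes the required sample size positive.\<close>
  have "0 < ln \<alpha> / ln p"
    using assms(3-6) by (simp add: divide_neg_neg)
  with assms(10) have "{1..n} \<noteq> {}" by auto
  have "measure M {\<omega> \<in> space M. \<forall>i\<in>{1..n}. X i \<omega> \<in> E} = measure (distr N borel Z) E ^ n"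
    using M.prob_all_iid_in[OF finite_atLeastAtMost \<open>{1..n} \<noteq> {}\<close> assms(8) E assms(9)] by simp
  also have "\<dots> \<le> p ^ n"
  proof (rule power_mono)
    have "Z -` E \<inter> space N = {\<omega> \<in> space N. even \<lfloor>2 powi k * \<bar>Z \<omega>\<bar>\<rfloor>}"
      by (auto simp: E_def)
    then show "measure (distr N borel Z) E \<le> p"
      using assms(7,11) E by (simp add: measure_distr contributing_bit_def)
  qed simp
  also have "\<dots> \<le> \<alpha>"
    using assms(3-5,10) by (intro power_le_of_ln_ratio_le)
  finally show ?thesis by (simp add: E_def)
qed

end
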